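(* Let $E=(e_{ij})$ be a symmetric $n\times n$ matrix with $e_{ii}=0$ for $i=1,\dots,n$ and $e_{ij}\geqslant 0$ (real) for any distinct $i,j\in\{1,\dots,n\}$. Let $r(E)$ be the spectral radius of $E$. If $r(E)=1$, then there exist a separable infinite dimensional Hilbert space $X$ and infinite dimensional closed subspaces $X_1,\dots,X_n$ of $X$ such that (1) $\|P_i|_{X_j}\|=e_{ij}$ for any distinct $i,j\in\{1,\dots,n\}$, where $P_i$ is the orthogonal projection onto $X_i$, $i=1,\dots,n$; (2) $X_1,\dots,X_n$ are linearly independent; (3) $X_1+\dots+X_n$ is not closed in $X$.
   Context: Hilbert spaces are over a base field of scalars which is either $\mathbb{R}$ or $\mathbb{C}$; the result is asserted for each of these two choices. The sum of subspaces is $X_1+\dots+X_n:=\{x_1+\dots+x_n \mid x_1\in X_1,\dots,x_n\in X_n\}$. The system of subspaces $X_1,\dots,X_n$ is called linearly independent if an equality $x_1+\dots+x_n=0$ with $x_1\in X_1,\dots,x_n\in X_n$ implies $x_1=\dots=x_n=0$. $\|P_i|_{X_j}\|$ is the operator norm of the restriction of $P_i$ to $X_j$. *)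

theory Defs
  imports
    "HOL-Analysis.Abstract_Metric_Spaces"
    "HOL-Library.Function_Algebras"
    "Jordan_Normal_Form.Spectral_Radius"
    "Jordan_Normal_Form.Conjugate"
begin

text \<open>Scalars: \<open>conjugate\<close> is the identity on \<^typ>\<open>real\<close> and \<^const>\<open>cnj\<close> on \<^typ>\<open>complex\<close>.\<close>

class hilbert_scalar = real_normed_field + conjugatable_field +
  assumes conjugate_mult_self_scaleR: "conjugate a * a = (norm a)\<^sup>2 *\<^sub>R 1"

lemma conjugate_mult_self:
  "conjugate a * a = of_real ((norm a)\<^sup>2)" for a :: "'a::hilbert_scalar"
  by (simp add: conjugate_mult_self_scaleR of_real_def)

instance real :: hilbert_scalar
  by standard (simp add: power2_eq_square)

instance complex :: hilbert_scalar
proof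
  fix a :: complex
  have "of_real ((norm a)\<^sup>2) = a * cnj a"
    by (rule complex_norm_square)
  then show "conjugate a * a = (norm a)\<^sup>2 *\<^sub>R 1"
    by (simp only: conjugate_complex_def scaleR_conv_of_real mult_1_right mult.commute[of a])
qed

text \<open>
  The library has no complex inner product spaces, and one cannot quantify existentially over
  types. A space is therefore given by a carrier \<open>H\<close>, a linear subspace of an algebraic vector
  space, together with an inner product \<open>ip\<close> (linear in the first argument) which is only
  constrained on \<open>H\<close>. Every separable Hilbert space is isomorphic to one carried by a subspace of
  \<open>nat \<Rightarrow> 'k\<close>, via its Fourier coefficients.
\<close>

locale inner_product_space = vector_space scale
  for scale :: "'k::hilbert_scalar \<Rightarrow> 'v::ab_group_add \<Rightarrow> 'v" +
  fixes H :: "'v set" and ip :: "'v \<Rightarrow> 'v \<Rightarrow> 'k"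
  assumes subspace_carrier: "subspace H"
    and ip_add_left: "\<lbrakk>x \<in> H; y \<in> H; z \<in> H\<rbrakk> \<Longrightarrow> ip (x + y) z = ip x z + ip y z"
    and ip_scale_left: "\<lbrakk>x \<in> H; y \<in> H\<rbrakk> \<Longrightarrow> ip (scale c x) y = c * ip x y"
    and ip_commute: "\<lbrakk>x \<in> H; y \<in> H\<rbrakk> \<Longrightarrow> ip y x = conjugate (ip x y)"
    and ip_nonneg: "x \<in> H \<Longrightarrow> \<exists>r\<ge>0. ip x x = of_real r"
    and ip_definite: "\<lbrakk>x \<in> H; ip x x = 0\<rbrakk> \<Longrightarrow> x = 0"
begin

definition hnorm :: "'v \<Rightarrow> real"
  where "hnorm x = sqrt (norm (ip x x))"

text \<open>The value off \<open>H\<close> is immaterial; it only serves the unconditional axioms of \<^locale>\<open>Metric_space\<close>.\<close>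

definition hdist :: "'v \<Rightarrow> 'v \<Rightarrow> real"
  where "hdist x y = (if x \<in> H \<and> y \<in> H then hnorm (x - y) else 0)"

lemma ip_self: "x \<in> H \<Longrightarrow> ip x x = of_real ((hnorm x)\<^sup>2)"
  using ip_nonneg[of x] by (auto simp: hnorm_def)

lemma hnorm_nonneg: "0 \<le> hnorm x"
  by (simp add: hnorm_def)

lemma hnorm_eq_0: "x \<in> H \<Longrightarrow> hnorm x = 0 \<longleftrightarrow> x = 0"
  using ip_definite[of x] ip_scale_left[of x x 0] by (auto simp: hnorm_def)

lemma ip_add_right:
  assumes "x \<in> H" "y \<in> H" "z \<in> H" shows "ip z (x + y) = ip z x + ip z y"
proof -
  have "ip z (x + y) = conjugate (ip (x + y) z)"
    using assms subspace_add[OF subspace_carrier] by (intro ip_commute) auto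
  also have "\<dots> = conjugate (ip x z) + conjugate (ip y z)"
    using assms by (simp add: ip_add_left conjugate_dist_add)
  finally show ?thesis
    using assms by (simp add: ip_commute[symmetric])
qed

lemma ip_scale_right:
  assumes "x \<in> H" "y \<in> H" shows "ip x (scale c y) = conjugate c * ip x y"
proof -
  have "ip x (scale c y) = conjugate (ip (scale c y) x)"
    using assms subspace_scale[OF subspace_carrier] by (intro ip_commute) auto
  also have "\<dots> = conjugate c * conjugate (ip y x)"
    using assms by (simp add: ip_scale_left conjugate_dist_mul)
  finally show ?thesis
    using assms by (simp add: ip_commute[symmetric])
qed

lemma ip_add_scale_self:
  assumes "x \<in> H" "y \<in> H"
  shows "ip (x + scale c y) (x + scale c y)
       = ip x x + conjugate c * ip x y + c * conjugate (ip x y) + c * conjugate c * ip y y"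
proof -
  have cy: "scale c y \<in> H"
    using assms(2) by (rule subspace_scale[OF subspace_carrier])
  have xcy: "x + scale c y \<in> H"
    using assms(1) cy by (rule subspace_add[OF subspace_carrier])
  have "ip (x + scale c y) (x + scale c y) = ip x (x + scale c y) + c * ip y (x + scale c y)"
    by (simp only: ip_add_left[OF assms(1) cy xcy] ip_scale_left[OF assms(2) xcy])
  also have "\<dots> = (ip x x + conjugate c * ip x y) + c * (ip y x + conjugate c * ip y y)"
    by (simp only: ip_add_right[OF assms(1) cy assms(1)] ip_add_right[OF assms(1) cy assms(2)]
        ip_scale_right[OF assms(1,2)] ip_scale_right[OF assms(2,2)])
  finally show ?thesis
    by (simp only: ip_commute[OF assms(1,2)] distrib_left add.assoc mult.assoc)
qed

lemma Cauchy_Schwarz: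
  assumes "x \<in> H" "y \<in> H" shows "norm (ip x y) \<le> hnorm x * hnorm y"
proof (cases "y = 0")
  case True
  then have "ip x y = 0"
    using ip_scale_right[OF assms, of 0] by simp
  then show ?thesis by (simp add: hnorm_nonneg)
next
  case False
  define s where "s = (hnorm y)\<^sup>2"
  have s: "s > 0"
    using False hnorm_eq_0[OF assms(2)] by (simp add: s_def)
  have conj_s: "conjugate (of_real s :: 'k) = of_real s"
    using ip_self[OF assms(2)] ip_commute[OF assms(2) assms(2)] by (simp add: s_def)
  define a where "a = ip x y"
  define c where "c = - a / of_real s"
  define z where "z = x + scale c y"
  have z: "z \<in> H"
    unfolding z_def
    using assms by (simp add: subspace_add subspace_carrier subspace_scale)
  have cs: "c * of_real s = - a"
    using s by (simp add: c_def)
  have "conjugate (c * of_real s) = conjugate (- a)"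
    by (simp only: cs)
  then have ccs: "conjugate c * of_real s = - conjugate a"
    by (simp add: conjugate_dist_mul conj_s conjugate_neg)
  have "ip z z = ip x x + conjugate c * a + c * conjugate a + c * conjugate c * of_real s"
    using ip_add_scale_self[OF assms, of c] ip_self[OF assms(2)]
    by (simp add: z_def a_def s_def)
  also have "\<dots> = ip x x + conjugate c * a + c * conjugate a + c * (conjugate c * of_real s)"
    by (simp add: mult.assoc)
  also have "\<dots> = ip x x + conjugate c * a"
    by (simp add: ccs)
  finally have zz: "ip z z = ip x x + conjugate c * a" .
  have "of_real s * ip z z = of_real s * ip x x + (conjugate c * of_real s) * a"
    by (simp only: zz distrib_left mult_ac)
  then have "of_real s * ip z z = of_real s * ip x x - conjugate a * a"
    by (simp add: ccs)
  then have "(of_real (s * (hnorm z)\<^sup>2) :: 'k) = of_real (s * (hnorm x)\<^sup>2 - (norm a)\<^sup>2)"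
    by (simp only: ip_self[OF z] ip_self[OF assms(1)] conjugate_mult_self of_real_mult of_real_diff)
  then have "s * (hnorm z)\<^sup>2 = s * (hnorm x)\<^sup>2 - (norm a)\<^sup>2"
    by (simp only: of_real_eq_iff)
  moreover have "0 \<le> s * (hnorm z)\<^sup>2"
    using s by simp
  ultimately have "(norm a)\<^sup>2 \<le> (hnorm x * hnorm y)\<^sup>2"
    by (simp add: s_def power_mult_distrib mult.commute)
  then show ?thesis
    unfolding a_def by (rule power2_le_imp_le) (simp add: hnorm_nonneg)
qed

lemma hnorm_triangle:
  assumes "x \<in> H" "y \<in> H" shows "hnorm (x + y) \<le> hnorm x + hnorm y"
proof -
  have xy: "x + y \<in> H"
    using assms by (simp add: subspace_add subspace_carrier)
  have "(hnorm (x + y))\<^sup>2 = norm (ip (x + y) (x + y))"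
    by (simp add: hnorm_def)
  also have "ip (x + y) (x + y) = ip x x + ip x y + ip y x + ip y y"
    using assms xy by (simp add: ip_add_left ip_add_right)
  also have "norm \<dots> \<le> norm (ip x x) + norm (ip x y) + norm (ip y x) + norm (ip y y)"
    by (intro order_trans[OF norm_triangle_ineq] add_mono order_refl)
  also have "\<dots> \<le> (hnorm x)\<^sup>2 + hnorm x * hnorm y + hnorm y * hnorm x + (hnorm y)\<^sup>2"
    using Cauchy_Schwarz[OF assms] Cauchy_Schwarz[OF assms(2,1)]
    by (intro add_mono) (simp_all add: hnorm_def)
  also have "\<dots> = (hnorm x + hnorm y)\<^sup>2"
    by (simp add: power2_eq_square algebra_simps)
  finally show ?thesis
    by (rule power2_le_imp_le) (simp add: hnorm_nonneg)
qed

lemma hnorm_minus: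
  assumes "x \<in> H" shows "hnorm (- x) = hnorm x"
proof -
  have one: "conjugate 1 = (1 :: 'k)"
    using conjugate_mult_self[of "1 :: 'k"] by simp
  have "- x \<in> H" using assms by (simp add: subspace_neg subspace_carrier)
  then have "ip (- x) (- x) = ip x x"
    using assms ip_scale_left[of x "- x" "- 1"] ip_scale_right[of x x "- 1"]
    by (simp add: conjugate_neg one)
  then show ?thesis by (simp add: hnorm_def)
qed

sublocale Metric_space H hdist
proof
  show "0 \<le> hdist x y" for x y
    by (simp add: hdist_def hnorm_nonneg)
  show "hdist x y = hdist y x" for x y
    using hnorm_minus[of "x - y"] by (auto simp: hdist_def subspace_diff subspace_carrier)
  show "hdist x y = 0 \<longleftrightarrow> x = y" if "x \<in> H" "y \<in> H" for x y
    using that by (simp add: hdist_def hnorm_eq_0 subspace_diff subspace_carrier)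
  show "hdist x z \<le> hdist x y + hdist y z" if "x \<in> H" "y \<in> H" "z \<in> H" for x y z
    using that hnorm_triangle[of "x - y" "y - z"]
    by (simp add: hdist_def subspace_diff subspace_carrier)
qed

definition closed_subspace :: "'v set \<Rightarrow> bool"
  where "closed_subspace S \<longleftrightarrow> subspace S \<and> closedin mtopology S"

text \<open>The library's \<open>dim\<close> is \<open>0\<close> on infinite dimensional subspaces, so it is of no use here.\<close>

definition infinite_dimensional :: "'v set \<Rightarrow> bool"
  where "infinite_dimensional S \<longleftrightarrow> (\<nexists>B. finite B \<and> span B = S)"

definition orth_proj :: "'v set \<Rightarrow> 'v \<Rightarrow> 'v"
  where "orth_proj S x = (THE p. p \<in> S \<and> (\<forall>y\<in>S. ip (x - p) y = 0))"

text \<open>Operator norm of the restriction of \<open>T\<close> to \<open>S\<close>.\<close>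

definition opnorm_on :: "'v set \<Rightarrow> ('v \<Rightarrow> 'v) \<Rightarrow> real"
  where "opnorm_on S T = (SUP x\<in>{x \<in> S. hnorm x \<le> 1}. hnorm (T x))"

end

locale hilbert_space = inner_product_space +
  assumes complete: "mcomplete"
begin

definition separable :: bool
  where "separable \<longleftrightarrow> separable_space mtopology"

end

definition subspace_sum :: "nat \<Rightarrow> (nat \<Rightarrow> 'v::comm_monoid_add set) \<Rightarrow> 'v set"
  where "subspace_sum n X = {\<Sum>i<n. x i |x. \<forall>i<n. x i \<in> X i}"

definition linearly_independent_subspaces :: "nat \<Rightarrow> (nat \<Rightarrow> 'v::comm_monoid_add set) \<Rightarrow> bool"
  where "linearly_independent_subspaces n X \<longleftrightarrow>
    (\<forall>x. (\<forall>i<n. x i \<in> X i) \<and> (\<Sum>i<n. x i) = 0 \<longrightarrow> (\<forall>i<n. x i = 0))"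

end

theory Submission
  imports Defs
begin

text \<open>
  Vectors \<open>v\<^sub>1, \<dots>, v\<^sub>n\<close> whose Gram matrix is \<open>I - tE\<close> satisfy \<open>\<bar>\<langle>v\<^sub>i, v\<^sub>j\<rangle>\<bar> = t e\<^sub>i\<^sub>j\<close> for
  \<open>i \<noteq> j\<close>. Such independent vectors exist for \<open>0 \<le> t < 1\<close>, because \<open>r(E) = 1\<close> makes \<open>I - tE\<close> positive
  definite, but they degenerate as \<open>t \<rightarrow> 1\<close>: for a vector \<open>u \<noteq> 0\<close> on which the quadratic form of
  \<open>E\<close> attains \<open>\<bar>u\<bar>\<^sup>2\<close>, the combination \<open>\<Sum>\<^sub>i u\<^sub>i v\<^sub>i\<close> has squared norm \<open>(1 - t) \<bar>u\<bar>\<^sup>2\<close>.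

  So take \<open>t\<^sub>k = 1 - 2\<^sup>-\<^sup>k\<^sup>-\<^sup>1\<close> and let \<open>X\<close> be the Hilbert sum over \<open>k\<close> of \<open>n\<close>-dimensional
  spaces, each with a basis \<open>v\<^sub>1\<^sup>k, \<dots>, v\<^sub>n\<^sup>k\<close> of Gram matrix \<open>I - t\<^sub>k E\<close>; let \<open>X\<^sub>i\<close> be the closed
  span of the \<open>v\<^sub>i\<^sup>k\<close> over all \<open>k\<close>. The norm of \<open>P\<^sub>i\<close> on \<open>X\<^sub>j\<close> is \<open>sup\<^sub>k t\<^sub>k e\<^sub>i\<^sub>j = e\<^sub>i\<^sub>j\<close>, and the
  \<open>X\<^sub>i\<close> are independent because each block is. The vector \<open>w = \<Sum>\<^sub>k \<Sum>\<^sub>i u\<^sub>i v\<^sub>i\<^sup>k\<close> lies in \<open>X\<close>, since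
  \<open>\<Sum>\<^sub>k (1 - t\<^sub>k)\<close> converges, and it is a limit of its truncations, which lie in \<open>X\<^sub>1 + \<dots> + X\<^sub>n\<close>. But
  its component in \<open>X\<^sub>i\<close> would have to be \<open>\<Sum>\<^sub>k u\<^sub>i v\<^sub>i\<^sup>k\<close>, which diverges when \<open>u\<^sub>i \<noteq> 0\<close>
  (\<open>sum_coord_spaces_not_closed\<close>).

  Concretely, a vector of \<open>X\<close> is the sequence of its coordinates with respect to the \<open>v\<^sub>i\<^sup>k\<close>, and the
  Gram matrices define the inner product, so that the \<open>v\<^sub>i\<^sup>k\<close> never have to be constructed. The
  locale \<open>gram_blocks\<close> carries this out for any sequence of positive definite Gram matrices.

  Two facts about \<open>E\<close> remain. Positive definiteness is \<open>quad_form_le\<close>: if \<open>E\<close> stretched some vector, its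
  powers would grow exponentially by symmetry, whereas \<open>r(E) \<le> 1\<close> only permits polynomial growth. The
  vector \<open>u\<close> is given by the absolute values of an eigenvector for an eigenvalue of modulus \<open>1\<close>
  (\<open>quad_form_attained\<close>); the triangle inequality for them relies on \<open>E \<ge> 0\<close>.
\<close>

section \<open>Conjugation of scalars\<close>

lemma norm_conjugate [simp]: "norm (conjugate a) = norm (a :: 'a :: hilbert_scalar)"
proof (cases "a = 0")
  case False
  have "norm (conjugate a) * norm a = norm (conjugate a * a)"
    by (simp only: norm_mult)
  also have "\<dots> = norm a * norm a"
    by (simp only: conjugate_mult_self norm_of_real) (simp add: power2_eq_square)
  finally show ?thesis using False by simp
qed simp

lemma conjugate_of_real [simp]: "conjugate (of_real r) = (of_real r :: 'a :: hilbert_scalar)"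
proof (cases "r = 0")
  case False
  have "conjugate (of_real r) * of_real r = (of_real r * of_real r :: 'a)"
    by (simp only: conjugate_mult_self norm_of_real) (simp add: power2_eq_square)
  then show ?thesis using False by simp
qed simp

text \<open>
  The axiom \<open>conjugate a * a = \<bar>a\<bar>\<^sup>2\<close> becomes \<open>a\<^sup>2 = \<bar>a\<bar>\<^sup>2\<close>, whose only solutions are \<open>\<plusminus>\<bar>a\<bar>\<close>.
\<close>

lemma conjugate_eq_self_imp_real:
  assumes "conjugate a = (a :: 'a :: hilbert_scalar)"
  obtains r where "a = of_real r"
proof -
  have "a * a = of_real (norm a) * of_real (norm a)"
    using conjugate_mult_self[of a] assms by (simp add: power2_eq_square)
  then have "a = of_real (norm a) \<or> a = of_real (- norm a)"
    by (simp add: square_eq_iff)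
  with that show ?thesis by blast
qed

lemma bounded_linear_conjugate: "bounded_linear (conjugate :: 'a :: hilbert_scalar \<Rightarrow> 'a)"
  by (rule bounded_linear_intro[of _ 1])
    (simp_all add: conjugate_dist_add conjugate_dist_mul scaleR_conv_of_real)

section \<open>Hilbert sums of spaces given by Gram matrices\<close>

definition fscale :: "'k::field \<Rightarrow> (nat \<Rightarrow> 'k) \<Rightarrow> nat \<Rightarrow> 'k"
  where "fscale c f = (\<lambda>l. c * f l)"

interpretation fscale: vector_space fscale
  by unfold_locales (auto simp: fscale_def fun_eq_iff algebra_simps)

text \<open>
  \<open>G k\<close> is the Gram matrix of the \<open>k\<close>-th block, and \<open>d k\<close> is a lower bound for its smallest eigenvalue.
  The bound depends on the block because, for unit basis vectors, a sum of coordinate subspaces can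
  only fail to be closed if \<open>d k\<close> comes arbitrarily close to \<open>0\<close>. The coordinate with respect to the \<open>i\<close>-th basis vector of
  block \<open>k\<close> has index \<open>k * n + i\<close>.
\<close>

locale gram_blocks =
  fixes n :: nat
    and G :: "nat \<Rightarrow> nat \<Rightarrow> nat \<Rightarrow> 'k::{hilbert_scalar, banach, second_countable_topology}"
    and d :: "nat \<Rightarrow> real"
  assumes n_pos: "0 < n"
    and hermitian: "\<lbrakk>i < n; j < n\<rbrakk> \<Longrightarrow> G k j i = conjugate (G k i j)"
    and d_pos: "0 < d k"
    and coercive: "\<exists>r. (\<Sum>i<n. \<Sum>j<n. G k i j * z i * conjugate (z j)) = of_real r
                     \<and> d k * (\<Sum>i<n. (norm (z i))\<^sup>2) \<le> r"
begin

definition form :: "nat \<Rightarrow> (nat \<Rightarrow> 'k) \<Rightarrow> (nat \<Rightarrow> 'k) \<Rightarrow> 'k"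
  where "form k x y = (\<Sum>i<n. \<Sum>j<n. G k i j * x (k * n + i) * conjugate (y (k * n + j)))"

definition q :: "nat \<Rightarrow> (nat \<Rightarrow> 'k) \<Rightarrow> real"
  where "q k x = norm (form k x x)"

definition H :: "(nat \<Rightarrow> 'k) set"
  where "H = {x. summable (\<lambda>k. q k x)}"

definition ip :: "(nat \<Rightarrow> 'k) \<Rightarrow> (nat \<Rightarrow> 'k) \<Rightarrow> 'k"
  where "ip x y = (\<Sum>k. form k x y)"

lemma form_add_left: "form k (x + y) z = form k x z + form k y z"
  by (simp add: form_def algebra_simps sum.distrib)

lemma form_scale_left: "form k (fscale c x) y = c * form k x y"
  by (simp add: form_def fscale_def sum_distrib_left algebra_simps)

lemma form_commute: "form k y x = conjugate (form k x y)"
proof -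
  have "conjugate (form k x y)
      = (\<Sum>i<n. \<Sum>j<n. conjugate (G k i j) * conjugate (x (k * n + i)) * y (k * n + j))"
    by (simp add: form_def sum_conjugate conjugate_dist_mul)
  also have "\<dots> = (\<Sum>i<n. \<Sum>j<n. G k j i * conjugate (x (k * n + i)) * y (k * n + j))"
    by (intro sum.cong refl) (simp add: hermitian[symmetric])
  also have "\<dots> = (\<Sum>j<n. \<Sum>i<n. G k j i * conjugate (x (k * n + i)) * y (k * n + j))"
    by (rule sum.swap)
  also have "\<dots> = form k y x"
    unfolding form_def by (intro sum.cong refl) (simp add: mult_ac)
  finally show ?thesis by simp
qed

lemma form_add_right: "form k z (x + y) = form k z x + form k z y"
  by (subst (1 2 3) form_commute) (simp add: form_add_left conjugate_dist_add)

lemma form_scale_right: "form k x (fscale c y) = conjugate c * form k x y"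
  by (subst (1 2) form_commute) (simp add: form_scale_left conjugate_dist_mul)

lemma q_nonneg [simp]: "0 \<le> q k x"
  by (simp add: q_def)

lemma form_self_lower:
  "form k x x = of_real (q k x)" "d k * (\<Sum>i<n. (norm (x (k * n + i)))\<^sup>2) \<le> q k x"
proof -
  obtain r where r: "form k x x = of_real r" "d k * (\<Sum>i<n. (norm (x (k * n + i)))\<^sup>2) \<le> r"
    using coercive[of k "\<lambda>i. x (k * n + i)"] by (auto simp: form_def)
  moreover have "0 \<le> r"
    using d_pos[of k] by (intro order_trans[OF _ r(2)] mult_nonneg_nonneg sum_nonneg) auto
  ultimately show "form k x x = of_real (q k x)"
    "d k * (\<Sum>i<n. (norm (x (k * n + i)))\<^sup>2) \<le> q k x"
    by (simp_all add: q_def)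
qed

lemma form_add_scale_self:
  "form k (x + fscale c y) (x + fscale c y)
   = form k x x + conjugate c * form k x y + c * conjugate (form k x y) + c * conjugate c * form k y y"
  using form_commute[of k x y]
  by (simp add: form_add_left form_add_right form_scale_left form_scale_right algebra_simps)

text \<open>
  This is the parallelogram law with the term \<open>q k (x - y)\<close> dropped.
\<close>

lemma q_add_le: "q k (x + y) \<le> 2 * q k x + 2 * q k y"
proof -
  have "form k (x + y) (x + y) + form k (x - y) (x - y) = 2 * form k x x + 2 * form k y y"
    using form_add_scale_self[of k x 1 y] form_add_scale_self[of k x "- 1" y]
      conjugate_of_real[of 1, where 'a = 'k]
    by (simp add: conjugate_neg)
  then have "(of_real (q k (x + y) + q k (x - y)) :: 'k) = of_real (2 * q k x + 2 * q k y)"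
    by (simp add: form_self_lower(1))
  then have "q k (x + y) + q k (x - y) = 2 * q k x + 2 * q k y"
    by (simp only: of_real_eq_iff)
  then show ?thesis
    using q_nonneg[of k "x - y"] by linarith
qed

lemma q_scale: "q k (fscale c x) = (norm c)\<^sup>2 * q k x"
  by (simp add: q_def form_scale_left form_scale_right norm_mult power2_eq_square)

text \<open>
  A weak form of the Cauchy-Schwarz inequality, sufficient for the convergence of the series
  defining \<open>ip\<close>. It is \<open>0 \<le> q k (x + c y)\<close> for the unit scalar \<open>c\<close> that makes the mixed term
  equal to \<open>- 2 \<bar>form k x y\<bar>\<close>.
\<close>

lemma norm_form_le: "norm (form k x y) \<le> q k x + q k y"
proof (cases "form k x y = 0")
  case False
  define b where "b = form k x y"
  \<comment> \<open>The phase of \<open>c\<close> is opposite to that of \<open>b\<close>, so that \<open>conjugate c * b = - \<bar>b\<bar>\<close>.\<close>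
  define c where "c = - b / of_real (norm b)"
  have b0: "b \<noteq> 0" using False by (simp add: b_def)
  have "conjugate c * of_real (norm b) = conjugate (c * of_real (norm b))"
    by (simp add: conjugate_dist_mul)
  also have "\<dots> = - conjugate b"
    using b0 by (simp add: c_def conjugate_neg)
  finally have "conjugate c * b * of_real (norm b) = - (conjugate b * b)"
    by (simp add: mult_ac)
  then have cb: "conjugate c * b = - of_real (norm b)"
    using b0 by (simp add: conjugate_mult_self power2_eq_square flip: minus_mult_left)
      (metis b0 minus_mult_left mult_cancel_right norm_eq_zero of_real_eq_0_iff)
  have "conjugate (conjugate c * b) = c * conjugate b"
    by (simp add: conjugate_dist_mul)
  then have cb': "c * conjugate b = - of_real (norm b)"
    by (simp add: cb conjugate_neg)
  have cc: "c * conjugate c = 1"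
    using conjugate_mult_self[of c] b0 by (simp add: c_def norm_divide mult.commute)
  have "of_real (q k (x + fscale c y)) = (of_real (q k x + q k y - 2 * norm b) :: 'k)"
    using form_add_scale_self[of k x c y]
    by (simp add: form_self_lower(1) cb cb' cc flip: b_def)
  then have "q k (x + fscale c y) = q k x + q k y - 2 * norm b"
    by (simp only: of_real_eq_iff)
  then show ?thesis
    using q_nonneg[of k "x + fscale c y"] norm_ge_zero[of b] unfolding b_def by linarith
qed simp

lemma summable_form: "\<lbrakk>x \<in> H; y \<in> H\<rbrakk> \<Longrightarrow> summable (\<lambda>k. form k x y)"
  by (rule summable_comparison_test'[of "\<lambda>k. q k x + q k y" 0])
    (simp_all add: H_def norm_form_le summable_add)

lemma summable_q: "x \<in> H \<Longrightarrow> summable (\<lambda>k. q k x)"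
  by (simp add: H_def)

lemma q_zero [simp]: "q k 0 = 0"
  by (simp add: q_def form_def)

lemma subspace_H: "fscale.subspace H"
proof (rule fscale.subspaceI)
  show "0 \<in> H" by (simp add: H_def)
  show "x + y \<in> H" if "x \<in> H" "y \<in> H" for x y
    unfolding H_def mem_Collect_eq
  proof (rule summable_comparison_test')
    show "summable (\<lambda>k. 2 * q k x + 2 * q k y)"
      using that by (intro summable_add summable_mult summable_q)
    show "norm (q k (x + y)) \<le> 2 * q k x + 2 * q k y" if "0 \<le> k" for k
      using q_add_le by simp
  qed
  show "fscale c x \<in> H" if "x \<in> H" for c x
    unfolding H_def mem_Collect_eq q_scale using that by (intro summable_mult summable_q)
qed

lemma ip_self_suminf: "x \<in> H \<Longrightarrow> ip x x = of_real (\<Sum>k. q k x)"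
  unfolding ip_def form_self_lower(1)
  by (rule bounded_linear.suminf[OF bounded_linear_of_real, symmetric]) (rule summable_q)

lemma norm_coord_le: "d (l div n) * (norm (x l))\<^sup>2 \<le> q (l div n) x"
proof -
  have "l = l div n * n + l mod n" by simp
  then have "(norm (x l))\<^sup>2 \<le> (\<Sum>i<n. (norm (x (l div n * n + i)))\<^sup>2)"
    using n_pos by (intro order_trans[OF _ member_le_sum[of "l mod n"]]) auto
  then have "d (l div n) * (norm (x l))\<^sup>2 \<le> d (l div n) * (\<Sum>i<n. (norm (x (l div n * n + i)))\<^sup>2)"
    using d_pos[of "l div n"] by (intro mult_left_mono) auto
  also have "\<dots> \<le> q (l div n) x" by (rule form_self_lower(2))
  finally show ?thesis .
qed

sublocale inner_product_space fscale H ip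
proof
  show "fscale.subspace H" by (rule subspace_H)
  show "ip (x + y) z = ip x z + ip y z" if "x \<in> H" "y \<in> H" "z \<in> H" for x y z
    using that by (simp add: ip_def form_add_left suminf_add summable_form)
  show "ip (fscale c x) y = c * ip x y" if "x \<in> H" "y \<in> H" for c x y
    using that by (simp add: ip_def form_scale_left suminf_mult summable_form)
  show "ip y x = conjugate (ip x y)" if "x \<in> H" "y \<in> H" for x y
    unfolding ip_def
    by (subst form_commute, rule bounded_linear.suminf[OF bounded_linear_conjugate, symmetric])
      (rule summable_form that)+
  show "\<exists>r\<ge>0. ip x x = of_real r" if "x \<in> H" for x
    using that by (intro exI[of _ "\<Sum>k. q k x"]) (simp add: ip_self_suminf suminf_nonneg summable_q)
  show "x = 0" if "x \<in> H" "ip x x = 0" for x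
  proof
    fix l
    have "q (l div n) x = 0"
      using that by (simp add: ip_self_suminf suminf_eq_zero_iff summable_q)
    then have "d (l div n) * (norm (x l))\<^sup>2 \<le> 0"
      using norm_coord_le[of l x] by simp
    then show "x l = 0 l"
      using d_pos[of "l div n"] by (simp add: mult_le_0_iff)
  qed
qed

lemma hnorm_sq: "x \<in> H \<Longrightarrow> (hnorm x)\<^sup>2 = (\<Sum>k. q k x)"
  by (simp add: hnorm_def ip_self_suminf suminf_nonneg summable_q)

text \<open>
  Coordinates are continuous functionals, with a bound that deteriorates with the block. Hence limits
  can be computed coordinatewise.
\<close>

lemma coord_le_hnorm:
  assumes "x \<in> H" shows "norm (x l) \<le> hnorm x / sqrt (d (l div n))"
proof -
  have "d (l div n) * (norm (x l))\<^sup>2 \<le> q (l div n) x" by (rule norm_coord_le)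
  also have "\<dots> \<le> (\<Sum>k. q k x)"
    using sum_le_suminf[OF summable_q[OF assms], of "{l div n}"] by simp
  also have "\<dots> = (hnorm x)\<^sup>2" using assms by (simp add: hnorm_sq)
  finally have "(norm (x l))\<^sup>2 \<le> (hnorm x / sqrt (d (l div n)))\<^sup>2"
    using d_pos[of "l div n"] by (simp add: power_divide pos_le_divide_eq mult.commute)
  then show ?thesis
    by (rule power2_le_imp_le) (use d_pos[of "l div n"] in \<open>simp add: hnorm_nonneg\<close>)
qed

lemma tendsto_q:
  assumes "\<And>l. (\<lambda>m. x m l) \<longlonglongrightarrow> y l"
  shows "(\<lambda>m. q k (x m)) \<longlonglongrightarrow> q k y"
  unfolding q_def form_def
  by (intro tendsto_intros assms bounded_linear.tendsto[OF bounded_linear_conjugate])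

lemma subspace_simps: "x \<in> H \<Longrightarrow> y \<in> H \<Longrightarrow> x - y \<in> H" "x \<in> H \<Longrightarrow> y \<in> H \<Longrightarrow> x + y \<in> H" "0 \<in> H"
  using subspace_H fscale.subspace_diff fscale.subspace_add fscale.subspace_0 by blast+

text \<open>
  A Cauchy sequence converges in every coordinate. Each finite partial sum of the squared distance
  involves finitely many coordinates, so the Cauchy estimate passes to the coordinatewise limit
  before the number of blocks is sent to infinity.
\<close>

lemma complete_H: "mcomplete"
  unfolding mcomplete_def
proof (intro allI impI)
  fix s assume s: "MCauchy s"
  have sH: "s m \<in> H" for m using s by (auto simp: MCauchy_def)
  have Cau: "\<exists>N. \<forall>m m'. N \<le> m \<longrightarrow> N \<le> m' \<longrightarrow> hnorm (s m - s m') < e" if "e > 0" for e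
    using s that sH by (auto simp: MCauchy_def hdist_def)
  have "Cauchy (\<lambda>m. s m l)" for l
  proof (rule metric_CauchyI)
    fix e :: real assume "e > 0"
    then have "e * sqrt (d (l div n)) > 0" using d_pos[of "l div n"] by simp
    from Cau[OF this] obtain N where
      N: "\<And>m m'. N \<le> m \<Longrightarrow> N \<le> m' \<Longrightarrow> hnorm (s m - s m') < e * sqrt (d (l div n))" by blast
    have "dist (s m l) (s m' l) < e" if "N \<le> m" "N \<le> m'" for m m'
    proof -
      have "norm (s m l - s m' l) \<le> hnorm (s m - s m') / sqrt (d (l div n))"
        using coord_le_hnorm[of "s m - s m'" l] sH by (simp add: subspace_simps)
      also have "\<dots> < e"
        using N[OF that] d_pos[of "l div n"] by (simp add: pos_divide_less_eq)
      finally show ?thesis by (simp add: dist_norm)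
    qed
    then show "\<exists>N. \<forall>m\<ge>N. \<forall>m'\<ge>N. dist (s m l) (s m' l) < e" by blast
  qed
  then have "\<exists>y. (\<lambda>m. s m l) \<longlonglongrightarrow> y" for l
    using Cauchy_convergent_iff convergent_def by blast
  then obtain y where y: "\<And>l. (\<lambda>m. s m l) \<longlonglongrightarrow> y l" by metis
  \<comment> \<open>Membership of \<open>y\<close> in \<open>H\<close> follows from that of \<open>s m - y\<close>, since \<open>y = s m - (s m - y)\<close>.\<close>
  have near: "\<exists>N. \<forall>m\<ge>N. s m - y \<in> H \<and> hnorm (s m - y) \<le> e" if "e > 0" for e
  proof -
    from Cau[OF that] obtain N where
      N: "\<And>m m'. N \<le> m \<Longrightarrow> N \<le> m' \<Longrightarrow> hnorm (s m - s m') < e" by blast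
    have "s m - y \<in> H \<and> hnorm (s m - y) \<le> e" if m: "N \<le> m" for m
    proof -
      have le: "(\<Sum>k<K. q k (s m - y)) \<le> e\<^sup>2" for K
      proof (rule LIMSEQ_le_const2)
        show "(\<lambda>m'. \<Sum>k<K. q k (s m - s m')) \<longlonglongrightarrow> (\<Sum>k<K. q k (s m - y))"
          by (intro tendsto_sum tendsto_q) (auto intro!: tendsto_intros y)
        have "(\<Sum>k<K. q k (s m - s m')) \<le> e\<^sup>2" if "N \<le> m'" for m'
        proof -
          have "(\<Sum>k<K. q k (s m - s m')) \<le> (\<Sum>k. q k (s m - s m'))"
            by (intro sum_le_suminf summable_q) (auto simp: sH subspace_simps)
          also have "\<dots> = (hnorm (s m - s m'))\<^sup>2"
            by (simp add: hnorm_sq sH subspace_simps)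
          also have "\<dots> \<le> e\<^sup>2"
            using N[OF m that] by (intro power_mono) (auto simp: hnorm_nonneg)
          finally show ?thesis .
        qed
        then show "\<exists>M. \<forall>m'\<ge>M. (\<Sum>k<K. q k (s m - s m')) \<le> e\<^sup>2" by blast
      qed
      have sm: "summable (\<lambda>k. q k (s m - y))"
        by (rule summableI_nonneg_bounded[OF q_nonneg le])
      then have H: "s m - y \<in> H" by (simp add: H_def)
      have "(hnorm (s m - y))\<^sup>2 \<le> e\<^sup>2"
        using H suminf_le_const[OF sm le] by (simp add: hnorm_sq)
      with H \<open>e > 0\<close> show ?thesis by (auto intro: power2_le_imp_le)
    qed
    then show ?thesis by blast
  qed
  from near[of 1] obtain N where "s N - y \<in> H" by auto
  then have yH: "y \<in> H"
    using subspace_simps(1)[OF sH[of N]] by fastforce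
  have "limitin mtopology s y sequentially"
    unfolding limit_metric_sequentially
  proof (intro conjI allI impI)
    fix e :: real assume "e > 0"
    then obtain N where N: "\<And>m. m \<ge> N \<Longrightarrow> hnorm (s m - y) \<le> e / 2"
      using near[of "e / 2"] by auto
    show "\<exists>N. \<forall>m\<ge>N. s m \<in> H \<and> hdist (s m) y < e"
      using N \<open>e > 0\<close> yH by (intro exI[of _ N]) (force simp: sH hdist_def)
  qed (rule yH)
  then show "\<exists>x. limitin mtopology s x sequentially" by (intro exI)
qed

sublocale hilbert_space fscale H ip
  by unfold_locales (rule complete_H)

lemma q_cong: "(\<And>i. i < n \<Longrightarrow> x (k * n + i) = y (k * n + i)) \<Longrightarrow> q k x = q k y"
  unfolding q_def form_def by (intro arg_cong[of _ _ norm] sum.cong refl) simp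

lemma q_eq_0: "(\<And>i. i < n \<Longrightarrow> x (k * n + i) = 0) \<Longrightarrow> q k x = 0"
  using q_cong[of x k 0] by simp

lemma finite_support:
  assumes "\<And>l. N * n \<le> l \<Longrightarrow> x l = 0"
  shows "x \<in> H" "(\<Sum>k. q k x) = (\<Sum>k<N. q k x)"
proof -
  have 0: "q k x = 0" if "N \<le> k" for k
    using that by (intro q_eq_0 assms) (simp add: trans_le_add1)
  show "x \<in> H"
    unfolding H_def mem_Collect_eq
    by (rule summable_finite[of "{..<N}"]) (auto simp: 0)
  show "(\<Sum>k. q k x) = (\<Sum>k<N. q k x)"
    by (rule suminf_finite) (auto simp: 0)
qed

lemma closed_subspace_coordinates: "closed_subspace {x \<in> H. \<forall>l\<in>L. x l = 0}"
proof -
  have "fscale.subspace {x \<in> H. \<forall>l\<in>L. x l = 0}"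
    using subspace_H by (auto simp: fscale.subspace_def) (auto simp: fscale_def)
  moreover have "closedin mtopology {x \<in> H. \<forall>l\<in>L. x l = 0}"
    unfolding metric_closedin_iff_sequentially_closed
  proof (intro conjI allI impI; (elim conjE)?)
    fix s x assume s: "range s \<subseteq> {x \<in> H. \<forall>l\<in>L. x l = 0}" and lim: "limitin mtopology s x sequentially"
    have xH: "x \<in> H" using lim by (simp add: limit_metric_sequentially)
    have "x l = 0" if l: "l \<in> L" for l
    proof (rule ccontr)
      assume "x l \<noteq> 0"
      then have "norm (x l) * sqrt (d (l div n)) > 0" using d_pos by simp
      then obtain m where m: "s m \<in> H" "hdist (s m) x < norm (x l) * sqrt (d (l div n))"
        using lim unfolding limit_metric_sequentially by (meson order_refl)
      have "norm (x l) = norm ((s m - x) l)" using s l by (auto simp: image_subset_iff)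
      also have "\<dots> \<le> hnorm (s m - x) / sqrt (d (l div n))"
        using m xH by (intro coord_le_hnorm subspace_simps)
      also have "\<dots> < norm (x l)"
        using m xH d_pos[of "l div n"] by (simp add: hdist_def pos_divide_less_eq)
      finally show False by simp
    qed
    with xH show "x \<in> {x \<in> H. \<forall>l\<in>L. x l = 0}" by simp
  qed auto
  ultimately show ?thesis by (simp add: closed_subspace_def)
qed

definition delta :: "nat \<Rightarrow> nat \<Rightarrow> 'k"
  where "delta l = (\<lambda>m. if m = l then 1 else 0)"

lemma delta_in_H: "delta l \<in> H"
proof (rule finite_support(1))
  fix m assume m: "Suc l * n \<le> m"
  have "l < Suc l * n" using n_pos by (cases n) auto
  with m show "delta l m = 0" by (auto simp: delta_def)
qed

lemma infinite_dimensional_if_delta: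
  assumes "infinite I" "\<And>l. l \<in> I \<Longrightarrow> delta l \<in> S"
  shows "infinite_dimensional S"
  unfolding infinite_dimensional_def
proof
  assume "\<exists>B. finite B \<and> fscale.span B = S"
  then obtain B where B: "finite B" "fscale.span B = S" by blast
  have inj: "inj_on delta I"
    by (rule inj_onI) (auto simp: delta_def fun_eq_iff split: if_splits)
  have "fscale.independent (delta ` I)"
    unfolding fscale.dependent_def
  proof clarify
    fix l assume "l \<in> I" and sp: "delta l \<in> fscale.span (delta ` I - {delta l})"
    \<comment> \<open>All the other unit vectors vanish at \<open>l\<close>.\<close>
    have "fscale.span (delta ` I - {delta l}) \<subseteq> {x. x l = 0}"
      by (rule fscale.span_minimal)
        (auto simp: delta_def fscale.subspace_def fscale_def)
    with sp show False by (auto simp: delta_def)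
  qed
  then have "finite (delta ` I)"
    using fscale.independent_span_bound[OF B(1)] B(2) assms(2) by blast
  with inj assms(1) show False by (simp add: finite_image_iff)
qed

definition trunc :: "nat \<Rightarrow> (nat \<Rightarrow> 'k) \<Rightarrow> nat \<Rightarrow> 'k"
  where "trunc N x = (\<lambda>l. if l < N * n then x l else 0)"

lemma trunc_in_H: "trunc N x \<in> H"
  by (rule finite_support(1)[of N]) (simp add: trunc_def)

lemma block_index_less: "i < n \<Longrightarrow> k * n + i < N * n \<longleftrightarrow> k < N"
  using n_pos by (metis add.commute div_less_iff_less_mult div_mult_self3 div_less add_0 less_not_refl)

text \<open>
  The squared distance from \<open>x\<close> to its truncation is a tail of the convergent series of the \<open>q k x\<close>.
\<close>

lemma trunc_tendsto:
  assumes "x \<in> H"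
  shows "(\<lambda>N. hnorm (x - trunc N x)) \<longlonglongrightarrow> 0"
proof -
  have H: "x - trunc N x \<in> H" for N using assms trunc_in_H by (rule subspace_simps)
  have "(\<Sum>k. q k (x - trunc N x)) = (\<Sum>k. q (k + N) x)" for N
  proof -
    have q: "q k (x - trunc N x) = (if k < N then 0 else q k x)" for k
      using q_eq_0[of "x - trunc N x" k] q_cong[of "x - trunc N x" k x]
      by (auto simp: trunc_def block_index_less)
    have "(\<Sum>k. q k (x - trunc N x)) = (\<Sum>k. q (k + N) (x - trunc N x)) + (\<Sum>k<N. q k (x - trunc N x))"
      by (rule suminf_split_initial_segment) (rule summable_q[OF H])
    then show ?thesis by (simp add: q)
  qed
  then have "hnorm (x - trunc N x) = sqrt (\<Sum>k. q (k + N) x)" for N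
    using hnorm_sq[OF H[of N]] by (simp add: real_sqrt_unique hnorm_nonneg)
  moreover have "(\<lambda>N. (\<Sum>k. q k x) - (\<Sum>k<N. q k x)) \<longlonglongrightarrow> (\<Sum>k. q k x) - (\<Sum>k. q k x)"
    by (intro tendsto_intros summable_LIMSEQ summable_q assms)
  then have "(\<lambda>N. sqrt (\<Sum>k. q (k + N) x)) \<longlonglongrightarrow> sqrt 0"
    using assms by (intro tendsto_real_sqrt) (simp add: suminf_minus_initial_segment[of "\<lambda>k. q k x"] summable_q)
  ultimately show ?thesis by simp
qed

lemma tendsto_hnorm_if_coordinates:
  assumes "\<And>l. (\<lambda>m. z m l) \<longlonglongrightarrow> 0" and "\<And>m l. N * n \<le> l \<Longrightarrow> z m l = 0"
  shows "(\<lambda>m. hnorm (z m)) \<longlonglongrightarrow> 0"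
proof -
  have "hnorm (z m) = sqrt (\<Sum>k<N. q k (z m))" for m
    using hnorm_sq[of "z m"] finite_support[of N "z m"] assms(2)
    by (simp add: real_sqrt_unique hnorm_nonneg)
  moreover have "(\<lambda>m. sqrt (\<Sum>k<N. q k (z m))) \<longlonglongrightarrow> sqrt (\<Sum>k<N. q k 0)"
    using assms(1) by (intro tendsto_real_sqrt tendsto_sum tendsto_q) simp
  ultimately show ?thesis by simp
qed

text \<open>
  The finitely supported vectors with coordinates in a countable dense set \<open>D\<close> of scalars are dense:
  truncate, then approximate the finitely many remaining coordinates.
\<close>

lemma separable_H: "separable"
proof -
  obtain D :: "'k set" where D: "countable D" "\<And>X. open X \<Longrightarrow> X \<noteq> {} \<Longrightarrow> \<exists>a\<in>D. a \<in> X"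
    using countable_dense_exists[where 'a = 'k] by blast
  define f :: "'k list \<Rightarrow> nat \<Rightarrow> 'k" where "f xs = (\<lambda>l. if l < length xs then xs ! l else 0)" for xs
  define C where "C = f ` lists D"
  have fH: "f xs \<in> H" for xs
  proof (rule finite_support(1))
    fix l assume "length xs * n \<le> l"
    moreover have "length xs \<le> length xs * n" using n_pos by (cases n) auto
    ultimately have "length xs \<le> l" by linarith
    then show "f xs l = 0" by (simp add: f_def)
  qed
  have "\<exists>y\<in>C. y \<in> mball x e" if x: "x \<in> H" and e: "e > 0" for x e
  proof -
    from trunc_tendsto[OF x] e obtain N where N: "hnorm (x - trunc N x) < e / 2"
      by (fastforce simp: LIMSEQ_iff hnorm_nonneg dest: spec[of _ "e / 2"])
    have "\<exists>a\<in>D. a \<in> ball (x l) (1 / Suc m)" for l m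
      by (rule D(2)) auto
    then obtain a where a: "\<And>l m. a l m \<in> D" "\<And>l m. dist (x l) (a l m) < 1 / Suc m"
      unfolding mem_ball by metis
    define y where "y m = f (map (\<lambda>l. a l m) [0..<N * n])" for m
    have y: "y m l = (if l < N * n then a l m else 0)" for m l
      by (simp add: y_def f_def)
    have "(\<lambda>m. (trunc N x - y m) l) \<longlonglongrightarrow> 0" for l
    proof (rule Lim_null_comparison)
      show "\<forall>\<^sub>F m in sequentially. norm ((trunc N x - y m) l) \<le> 1 / Suc m"
        using a(2)[of l] by (intro always_eventually) (auto simp: y trunc_def dist_norm less_imp_le)
      show "(\<lambda>m. 1 / real (Suc m)) \<longlonglongrightarrow> 0" by (rule LIMSEQ_Suc[OF lim_1_over_n])
    qed
    then have "(\<lambda>m. hnorm (trunc N x - y m)) \<longlonglongrightarrow> 0"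
      by (rule tendsto_hnorm_if_coordinates[of _ N]) (simp add: y trunc_def)
    then obtain m where m: "hnorm (trunc N x - y m) < e / 2"
      using e by (fastforce simp: LIMSEQ_iff hnorm_nonneg dest: spec[of _ "e / 2"])
    have yC: "y m \<in> C" unfolding C_def y_def by (rule imageI) (auto simp: a(1))
    have yH: "y m \<in> H" by (simp add: y_def fH)
    have "hnorm (x - y m) = hnorm ((x - trunc N x) + (trunc N x - y m))" by simp
    also have "\<dots> \<le> hnorm (x - trunc N x) + hnorm (trunc N x - y m)"
      using x yH trunc_in_H by (intro hnorm_triangle subspace_simps)
    also have "\<dots> < e" using N m by simp
    finally show ?thesis
      using yC x yH by (auto simp: hdist_def)
  qed
  then have "mtopology closure_of C = H"
    by (auto simp: metric_closure_of)
  moreover have "countable C" using D(1) by (simp add: C_def)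
  moreover have "C \<subseteq> H" using fH by (auto simp: C_def)
  ultimately show ?thesis
    by (auto simp: separable_def separable_space_def)
qed

section \<open>The coordinate subspaces and their sum\<close>

definition coord_space :: "nat \<Rightarrow> (nat \<Rightarrow> 'k) set"
  where "coord_space i = {x \<in> H. \<forall>l\<in>{l. l mod n \<noteq> i}. x l = 0}"

lemma closed_coord_space: "closed_subspace (coord_space i)"
  unfolding coord_space_def by (rule closed_subspace_coordinates)

lemma infinite_dimensional_coord_space:
  assumes "i < n" shows "infinite_dimensional (coord_space i)"
proof (rule infinite_dimensional_if_delta)
  have "inj (\<lambda>k. k * n + i)" using n_pos by (auto simp: inj_def)
  then show "infinite (range (\<lambda>k. k * n + i))" by (rule range_inj_infinite)
  show "delta l \<in> coord_space i" if "l \<in> range (\<lambda>k. k * n + i)" for l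
    using that assms by (auto simp: coord_space_def delta_in_H) (auto simp: delta_def)
qed

lemma infinite_dimensional_H: "infinite_dimensional H"
  by (rule infinite_dimensional_if_delta[of UNIV]) (auto simp: delta_in_H)

lemma form_coord_space:
  assumes "x \<in> coord_space j" "y \<in> coord_space i" "i < n" "j < n"
  shows "form k x y = G k j i * x (k * n + j) * conjugate (y (k * n + i))"
proof -
  have x: "x (k * n + a) = (if a = j then x (k * n + j) else 0)" if "a < n" for a
    using assms(1) that by (auto simp: coord_space_def)
  have y: "y (k * n + a) = (if a = i then y (k * n + i) else 0)" if "a < n" for a
    using assms(2) that by (auto simp: coord_space_def)
  have "form k x y = (\<Sum>a<n. \<Sum>b<n. if a = j then (if b = i then G k j i * x (k * n + j) * conjugate (y (k * n + i)) else 0) else 0)"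
    unfolding form_def
  proof (intro sum.cong refl)
    fix a b assume "a \<in> {..<n}" "b \<in> {..<n}"
    then have ab: "a < n" "b < n" by auto
    show "G k a b * x (k * n + a) * conjugate (y (k * n + b)) =
       (if a = j then (if b = i then G k j i * x (k * n + j) * conjugate (y (k * n + i)) else 0) else 0)"
      by (subst x[OF ab(1)], subst y[OF ab(2)]) auto
  qed
  also have "\<dots> = (\<Sum>a<n. if a = j then G k j i * x (k * n + j) * conjugate (y (k * n + i)) else 0)"
    using assms(3) by (intro sum.cong refl) simp
  also have "\<dots> = G k j i * x (k * n + j) * conjugate (y (k * n + i))"
    using assms(4) by simp
  finally show ?thesis .
qed

lemma q_coord_space:
  assumes "x \<in> coord_space i" "i < n" "G k i i = 1"
  shows "q k x = (norm (x (k * n + i)))\<^sup>2"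
  using form_coord_space[OF assms(1,1,2,2)] assms(3)
  by (simp add: q_def norm_mult power2_eq_square)

text \<open>
  The same formula without assuming that \<open>x\<close> belongs to \<open>H\<close>; it serves to prove that the candidate
  for an orthogonal projection does.
\<close>

lemma q_supported:
  assumes "\<And>l. l mod n \<noteq> i \<Longrightarrow> x l = 0" "i < n" "\<And>k. G k i i = 1"
  shows "q k x = (norm (x (k * n + i)))\<^sup>2"
proof -
  have "trunc (Suc k) x \<in> coord_space i"
    using assms(1) unfolding coord_space_def by (auto simp: trunc_in_H) (simp add: trunc_def)
  then have "q k (trunc (Suc k) x) = (norm (x (k * n + i)))\<^sup>2"
    using q_coord_space[of "trunc (Suc k) x" i k] assms(2,3) 
    by (simp add: trunc_def)
  moreover have "q k (trunc (Suc k) x) = q k x"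
    by (rule q_cong) (simp add: trunc_def)
  ultimately show ?thesis by simp
qed

text \<open>
  In block \<open>k\<close> the two subspaces are the lines through the unit vectors \<open>v\<^sub>j\<close> and \<open>v\<^sub>i\<close>, and the
  projection sends \<open>v\<^sub>j\<close> to \<open>\<langle>v\<^sub>j, v\<^sub>i\<rangle> v\<^sub>i = G k j i v\<^sub>i\<close>.
\<close>

lemma orth_proj_coord_space:
  assumes x: "x \<in> coord_space j" and ij: "i < n" "j < n"
    and G1: "\<And>k i. i < n \<Longrightarrow> G k i i = 1" and Gc: "\<And>k. norm (G k j i) \<le> c"
  defines "p \<equiv> (\<lambda>l. if l mod n = i then G (l div n) j i * x (l div n * n + j) else 0)"
  shows "p \<in> coord_space i" "orth_proj (coord_space i) x = p"
    "\<And>k. q k p = (norm (G k j i))\<^sup>2 * q k x"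
proof -
  show qp: "q k p = (norm (G k j i))\<^sup>2 * q k x" for k
    using ij n_pos q_coord_space[OF x ij(2) G1, of k] q_supported[of i p k] G1
    by (simp add: p_def norm_mult power_mult_distrib)
  have xH: "x \<in> H" using x by (simp add: coord_space_def)
  have "summable (\<lambda>k. q k p)"
  proof (rule summable_comparison_test')
    show "summable (\<lambda>k. c\<^sup>2 * q k x)" using xH by (intro summable_mult summable_q)
    show "norm (q k p) \<le> c\<^sup>2 * q k x" if "0 \<le> k" for k
      using Gc[of k] by (auto simp: qp intro!: mult_right_mono power_mono)
  qed
  then have pH: "p \<in> H" by (simp add: H_def)
  then show pX: "p \<in> coord_space i" by (simp add: coord_space_def p_def)
  have orth: "ip (x - p) y = 0" if y: "y \<in> coord_space i" for y
  proof -
    have yH: "y \<in> H" using y by (simp add: coord_space_def)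
    have "form k x y = form k p y" for k
      using form_coord_space[OF x y ij] form_coord_space[OF pX y ij(1,1)] ij G1
      by (simp add: p_def)
    then have "ip x y = ip p y" by (simp add: ip_def)
    moreover have "ip x y = ip (x - p) y + ip p y"
      using ip_add_left[of "x - p" p y] xH pH yH by (simp add: subspace_simps)
    ultimately show ?thesis by simp
  qed
  show "orth_proj (coord_space i) x = p"
    unfolding orth_proj_def
  proof (rule the_equality)
    fix p' assume p': "p' \<in> coord_space i \<and> (\<forall>y\<in>coord_space i. ip (x - p') y = 0)"
    have p'H: "p' \<in> H" using p' by (simp add: coord_space_def)
    have diff: "p' - p \<in> coord_space i"
      using p' pX by (auto simp: coord_space_def subspace_simps)
    then have "ip (x - p') (p' - p) = 0" "ip (x - p) (p' - p) = 0"
      using p' orth by auto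
    moreover have "ip (x - p) (p' - p) = ip (x - p') (p' - p) + ip (p' - p) (p' - p)"
      using ip_add_left[of "x - p'" "p' - p" "p' - p"] xH pH p'H by (simp add: subspace_simps)
    ultimately have "ip (p' - p) (p' - p) = 0" by simp
    then show "p' = p"
      using ip_definite[of "p' - p"] pH p'H by (simp add: subspace_simps)
  qed (use pX orth in auto)
qed

text \<open>
  The norm is \<open>sup\<^sub>k \<bar>G k j i\<bar>\<close>, since the projection acts blockwise; the \<open>k\<close>-th value is reached at the
  \<open>j\<close>-th basis vector of block \<open>k\<close>.
\<close>

lemma opnorm_coord_space:
  assumes ij: "i < n" "j < n"
    and G1: "\<And>k i. i < n \<Longrightarrow> G k i i = 1" and Gc: "\<And>k. norm (G k j i) \<le> c"
    and lim: "(\<lambda>k. norm (G k j i)) \<longlonglongrightarrow> c"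
  shows "opnorm_on (coord_space j) (orth_proj (coord_space i)) = c"
proof -
  let ?B = "{x \<in> coord_space j. hnorm x \<le> 1}"
  let ?P = "\<lambda>x. hnorm (orth_proj (coord_space i) x)"
  have c0: "0 \<le> c" using Gc[of 0] norm_ge_zero order_trans by blast
  have sq: "(?P x)\<^sup>2 = (\<Sum>k. (norm (G k j i))\<^sup>2 * q k x)"
    "summable (\<lambda>k. (norm (G k j i))\<^sup>2 * q k x)" if "x \<in> coord_space j" for x
    using orth_proj_coord_space[OF that ij G1 Gc]
      hnorm_sq[of "orth_proj (coord_space i) x"] summable_q[of "orth_proj (coord_space i) x"]
    by (simp_all add: coord_space_def)
  have le: "?P x \<le> c" if x: "x \<in> ?B" for x
  proof -
    have xH: "x \<in> H" using x by (simp add: coord_space_def)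
    have "(?P x)\<^sup>2 \<le> (\<Sum>k. c\<^sup>2 * q k x)"
      using x sq[of x] Gc xH
      by (auto intro!: suminf_le mult_right_mono power_mono summable_mult summable_q)
    also have "\<dots> = c\<^sup>2 * (hnorm x)\<^sup>2"
      using xH by (simp add: suminf_mult summable_q hnorm_sq)
    also have "\<dots> \<le> c\<^sup>2 * 1"
      using x by (intro mult_left_mono) (auto simp: hnorm_nonneg power_le_one)
    finally show ?thesis using c0 by (auto intro: power2_le_imp_le)
  qed
  have ge: "norm (G k j i) \<le> opnorm_on (coord_space j) (orth_proj (coord_space i))" for k
  proof -
    let ?x = "delta (k * n + j)"
    have X: "?x \<in> coord_space j"
      using ij by (auto simp: coord_space_def delta_in_H) (auto simp: delta_def)
    have q: "q k' ?x = (if k' = k then 1 else 0)" for k'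
      using q_coord_space[OF X ij(2) G1[OF ij(2)], of k'] n_pos by (simp add: delta_def)
    have "(hnorm ?x)\<^sup>2 = 1"
      using suminf_finite[of "{k}" "\<lambda>k'. q k' ?x"] by (simp add: hnorm_sq delta_in_H q)
    then have xB: "?x \<in> ?B" using X hnorm_nonneg[of ?x] by (simp add: power2_eq_1_iff)
    have "(?P ?x)\<^sup>2 = (norm (G k j i))\<^sup>2"
      using suminf_finite[of "{k}" "\<lambda>k'. (norm (G k' j i))\<^sup>2 * q k' ?x"] by (simp add: sq[OF X] q)
    then have "norm (G k j i) = ?P ?x"
      by (metis hnorm_nonneg norm_ge_zero power2_eq_imp_eq)
    also have "\<dots> \<le> opnorm_on (coord_space j) (orth_proj (coord_space i))"
      unfolding opnorm_on_def using xB le by (intro cSUP_upper bdd_aboveI2[of _ _ c])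
    finally show ?thesis .
  qed
  have "0 \<in> ?B" using subspace_simps(3) hnorm_eq_0[of 0] by (simp add: coord_space_def)
  then have "opnorm_on (coord_space j) (orth_proj (coord_space i)) \<le> c"
    unfolding opnorm_on_def using le by (intro cSUP_least) auto
  moreover have "c \<le> opnorm_on (coord_space j) (orth_proj (coord_space i))"
    using LIMSEQ_le_const2[OF lim] ge by blast
  ultimately show ?thesis by simp
qed

lemma independent_coord_spaces: "linearly_independent_subspaces n coord_space"
  unfolding linearly_independent_subspaces_def
proof (intro allI impI, elim conjE)
  fix x i assume X: "\<forall>i<n. x i \<in> coord_space i" and S: "(\<Sum>i<n. x i) = 0" and i: "i < n"
  show "x i = 0"
  proof
    fix l
    show "x i l = 0 l"
    proof (cases "l mod n = i")
      case True
      have "0 = (\<Sum>a<n. x a) l" using S by simp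
      also have "\<dots> = (\<Sum>a<n. x a l)" by (induction n) auto
      also have "\<dots> = (\<Sum>a<n. if a = i then x i l else 0)"
        using X True by (intro sum.cong refl) (auto simp: coord_space_def)
      also have "\<dots> = x i l" using i by simp
      finally show ?thesis by simp
    qed (use X i in \<open>auto simp: coord_space_def\<close>)
  qed
qed

text \<open>
  The truncations of \<open>w\<close> lie in the sum and converge to \<open>w\<close>. Were \<open>w\<close> itself in the sum, its summand
  in the \<open>i\<close>-th subspace would have the coordinates \<open>w (k * n + i)\<close>, whose squares would be summable.
\<close>

lemma sum_coord_spaces_not_closed:
  assumes w: "w \<in> H" and i: "i < n" and G1: "\<And>k. G k i i = 1"
    and ns: "\<not> summable (\<lambda>k. (norm (w (k * n + i)))\<^sup>2)"
  shows "\<not> closedin mtopology (subspace_sum n coord_space)"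
proof
  assume closed: "closedin mtopology (subspace_sum n coord_space)"
  have sum_apply: "(\<Sum>a<m. x a) l = (\<Sum>a<m. x a l)" for x :: "nat \<Rightarrow> nat \<Rightarrow> 'k" and m l
    by (induction m) auto
  have T: "trunc N w \<in> subspace_sum n coord_space" for N
  proof -
    define x where "x a = (\<lambda>l. if l mod n = a then trunc N w l else 0)" for a
    have "x a \<in> H" for a by (rule finite_support(1)[of N]) (simp add: x_def trunc_def)
    then have "\<forall>a<n. x a \<in> coord_space a" by (simp add: coord_space_def x_def)
    moreover have "trunc N w = (\<Sum>a<n. x a)"
      using n_pos by (auto simp: fun_eq_iff sum_apply x_def)
    ultimately show ?thesis by (auto simp: subspace_sum_def)
  qed
  have "limitin mtopology (\<lambda>N. trunc N w) w sequentially"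
    unfolding limit_metric_sequentially
  proof (intro conjI allI impI)
    fix e :: real assume "e > 0"
    then obtain N where N: "\<And>m. m \<ge> N \<Longrightarrow> hnorm (w - trunc m w) < e"
      using trunc_tendsto[OF w] by (auto simp: LIMSEQ_iff hnorm_nonneg)
    then show "\<exists>N. \<forall>m\<ge>N. trunc m w \<in> H \<and> hdist (trunc m w) w < e"
      using w by (intro exI[of _ N]) (simp add: commute[of _ w], simp add: hdist_def trunc_in_H)
  qed (rule w)
  moreover have "\<And>s l. range s \<subseteq> subspace_sum n coord_space \<Longrightarrow>
      limitin mtopology s l sequentially \<Longrightarrow> l \<in> subspace_sum n coord_space"
    using closed by (simp add: metric_closedin_iff_sequentially_closed)
  moreover have "range (\<lambda>N. trunc N w) \<subseteq> subspace_sum n coord_space"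
    using T by (rule image_subsetI)
  ultimately have "w \<in> subspace_sum n coord_space"
    by metis
  then obtain x where x: "w = (\<Sum>a<n. x a)" "\<And>a. a < n \<Longrightarrow> x a \<in> coord_space a"
    by (auto simp: subspace_sum_def)
  have "w (k * n + i) = x i (k * n + i)" for k
  proof -
    have "w (k * n + i) = (\<Sum>a<n. if a = i then x i (k * n + i) else 0)"
      unfolding x(1) sum_apply
      using x(2) i by (intro sum.cong refl) (auto simp: coord_space_def)
    then show ?thesis using i by simp
  qed
  then have "(\<lambda>k. (norm (w (k * n + i)))\<^sup>2) = (\<lambda>k. q k (x i))"
    using q_coord_space[OF x(2)[OF i] i G1] by simp
  moreover have "summable (\<lambda>k. q k (x i))"
    using x(2)[OF i] by (intro summable_q) (simp add: coord_space_def)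
  ultimately show False using ns by simp
qed

end

section \<open>The quadratic form of a symmetric matrix of spectral radius at most one\<close>

interpretation of_real_hom: semiring_hom "of_real :: real \<Rightarrow> complex"
  by unfold_locales auto

text \<open>
  Log-convexity means that the ratios \<open>a (m + 1) / a m\<close> increase, so they all exceed the first one.
\<close>

lemma log_convex_growth:
  fixes a :: "nat \<Rightarrow> real"
  assumes nonneg: "\<And>m. 0 \<le> a m" and lc: "\<And>m. (a (Suc m))\<^sup>2 \<le> a m * a (Suc (Suc m))"
    and gt: "a 0 < a 1"
  shows "0 < a 0" "a 0 * (a 1 / a 0) ^ m \<le> a m"
proof -
  show a0: "0 < a 0"
  proof (rule ccontr)
    assume "\<not> 0 < a 0"
    then have "a 0 = 0" using nonneg[of 0] by simp
    with lc[of 0] gt show False by simp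
  qed
  define r where "r = a 1 / a 0"
  have r: "1 < r" using a0 gt by (simp add: r_def)
  have step: "0 < a m \<and> r * a m \<le> a (Suc m)" for m
  proof (induction m)
    case 0
    show ?case using a0 by (simp add: r_def)
  next
    case (Suc m)
    then have m: "0 < a m" "r * a m \<le> a (Suc m)" by auto
    have pos: "0 < a (Suc m)" using m r by (smt (verit) mult_pos_pos)
    have "(r * a m) * a (Suc m) \<le> a (Suc m) * a (Suc m)"
      using m pos by (intro mult_right_mono) auto
    also have "\<dots> \<le> a m * a (Suc (Suc m))" using lc[of m] by (simp add: power2_eq_square)
    finally have "a m * (r * a (Suc m)) \<le> a m * a (Suc (Suc m))" by (simp add: mult_ac)
    then show ?case using m(1) pos by simp
  qed
  have "a 0 * r ^ m \<le> a m"
  proof (induction m)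
    case (Suc m)
    have "a 0 * r ^ Suc m = r * (a 0 * r ^ m)" by simp
    also have "\<dots> \<le> r * a m" using Suc r by (intro mult_left_mono) auto
    also have "\<dots> \<le> a (Suc m)" using step by blast
    finally show ?case .
  qed simp
  then show "a 0 * (a 1 / a 0) ^ m \<le> a m" by (simp add: r_def)
qed

lemma power_times_geometric_tendsto_0:
  fixes s :: real
  assumes "0 < s" "s < 1"
  shows "(\<lambda>m. real m ^ e * s ^ m) \<longlonglongrightarrow> 0"
  using assms
proof (induction e arbitrary: s)
  case 0
  then show ?case by (simp add: LIMSEQ_realpow_zero)
next
  case (Suc e)
  have s: "0 < sqrt s" "sqrt s < 1" using Suc.prems by auto
  \<comment> \<open>Splitting \<open>s = sqrt s * sqrt s\<close> leaves a geometric factor for each of \<open>m\<close> and \<open>m ^ e\<close>.\<close>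
  have "(\<lambda>m. (real m * sqrt s ^ m) * (real m ^ e * sqrt s ^ m)) \<longlonglongrightarrow> 0 * 0"
    using s by (intro tendsto_mult powser_times_n_limit_0 Suc.IH) auto
  moreover have "sqrt s ^ m * sqrt s ^ m = s ^ m" for m
    using Suc.prems by (simp flip: power_mult_distrib)
  ultimately show ?case by (simp add: mult_ac)
qed

lemma exponential_exceeds_polynomial:
  fixes r s C c1 c2 :: real
  assumes "1 < r" "0 < s"
  shows "\<exists>m. C * (c1 + c2 * real m ^ e)\<^sup>2 < s * r ^ m"
proof -
  define t where "t = 1 / r"
  have t: "0 < t" "t < 1" using assms by (auto simp: t_def)
  have "(\<lambda>m. C * (c1\<^sup>2 * t ^ m + 2 * c1 * c2 * (real m ^ e * t ^ m) + c2\<^sup>2 * (real m ^ (2 * e) * t ^ m)))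
      \<longlonglongrightarrow> C * (c1\<^sup>2 * 0 + 2 * c1 * c2 * 0 + c2\<^sup>2 * 0)"
    using t by (intro tendsto_intros power_times_geometric_tendsto_0 LIMSEQ_realpow_zero) auto
  then have "\<forall>\<^sub>F m in sequentially.
      C * (c1\<^sup>2 * t ^ m + 2 * c1 * c2 * (real m ^ e * t ^ m) + c2\<^sup>2 * (real m ^ (2 * e) * t ^ m)) < s"
    by (rule order_tendstoD) (simp add: assms)
  then obtain m where
    m: "C * (c1\<^sup>2 * t ^ m + 2 * c1 * c2 * (real m ^ e * t ^ m) + c2\<^sup>2 * (real m ^ (2 * e) * t ^ m)) < s"
    by (auto simp: eventually_sequentially)
  have "C * (c1 + c2 * real m ^ e)\<^sup>2 * t ^ m < s"
    using m by (simp add: power2_sum power_mult_distrib algebra_simps flip: power_mult)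
  then have "C * (c1 + c2 * real m ^ e)\<^sup>2 < s * r ^ m"
    using assms(1) by (simp add: t_def power_divide divide_less_eq)
  then show ?thesis ..
qed

context
  fixes n :: nat and E :: "real mat"
  assumes E: "E \<in> carrier_mat n n" and sym: "transpose_mat E = E"
begin

definition mat_app :: "(nat \<Rightarrow> real) \<Rightarrow> nat \<Rightarrow> real"
  where "mat_app x i = (\<Sum>j<n. E $$ (i, j) * x j)"

lemma E_sym: "i < n \<Longrightarrow> j < n \<Longrightarrow> E $$ (j, i) = E $$ (i, j)"
  using E sym by (metis carrier_matD index_transpose_mat(1))

lemma mat_app_self_adjoint: "(\<Sum>i<n. mat_app x i * y i) = (\<Sum>i<n. x i * mat_app y i)"
proof -
  have "(\<Sum>i<n. mat_app x i * y i) = (\<Sum>i<n. \<Sum>j<n. E $$ (i, j) * x j * y i)"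
    by (simp add: mat_app_def sum_distrib_right)
  also have "\<dots> = (\<Sum>j<n. \<Sum>i<n. E $$ (i, j) * x j * y i)" by (rule sum.swap)
  also have "\<dots> = (\<Sum>j<n. x j * mat_app y j)"
    unfolding mat_app_def sum_distrib_left by (intro sum.cong refl) (simp add: E_sym)
  finally show ?thesis .
qed

lemma funpow_mat_app: "i < n \<Longrightarrow> (mat_app ^^ m) x i = (\<Sum>j<n. (E ^\<^sub>m m) $$ (i, j) * x j)"
proof (induction m arbitrary: x)
  case 0
  then have "(\<Sum>j<n. (E ^\<^sub>m 0) $$ (i, j) * x j) = (\<Sum>j<n. if j = i then x i else 0)"
    using E by (intro sum.cong refl) auto
  with 0 show ?case by simp
next
  case (Suc m)
  have pc: "E ^\<^sub>m m \<in> carrier_mat n n" using E by simp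
  have "(mat_app ^^ Suc m) x i = (mat_app ^^ m) (mat_app x) i" by (simp add: funpow_swap1)
  also have "\<dots> = (\<Sum>j<n. \<Sum>l<n. (E ^\<^sub>m m) $$ (i, j) * (E $$ (j, l) * x l))"
    unfolding Suc.IH[OF Suc.prems] by (simp add: mat_app_def sum_distrib_left)
  also have "\<dots> = (\<Sum>l<n. \<Sum>j<n. (E ^\<^sub>m m) $$ (i, j) * (E $$ (j, l) * x l))"
    by (rule sum.swap)
  also have "\<dots> = (\<Sum>l<n. (E ^\<^sub>m Suc m) $$ (i, l) * x l)"
    using pc E Suc.prems
    by (intro sum.cong refl)
      (simp add: scalar_prod_def sum_distrib_right mult.assoc lessThan_atLeast0)
  finally show ?case .
qed

text \<open>
  By self-adjointness and the Cauchy-Schwarz inequality the squared norms of \<open>E\<^sup>m x\<close> form a log-convex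
  sequence. If \<open>\<bar>E x\<bar> > \<bar>x\<bar>\<close>, they therefore grow exponentially. The Jordan normal form of \<open>E\<close> bounds
  the entries of \<open>E\<^sup>m\<close> by a polynomial in \<open>m\<close>, a contradiction.
\<close>

lemma mat_app_contraction:
  assumes rho: "spectral_radius (map_mat complex_of_real E) \<le> 1"
  shows "(\<Sum>i<n. (mat_app x i)\<^sup>2) \<le> (\<Sum>i<n. (x i)\<^sup>2)"
proof (rule ccontr)
  assume not: "\<not> ?thesis"
  define a where "a m = (\<Sum>i<n. ((mat_app ^^ m) x i)\<^sup>2)" for m
  have nonneg: "0 \<le> a m" for m by (simp add: a_def sum_nonneg)
  have lc: "(a (Suc m))\<^sup>2 \<le> a m * a (Suc (Suc m))" for m
  proof -
    have "a (Suc m) = (\<Sum>i<n. mat_app ((mat_app ^^ m) x) i * (mat_app ^^ Suc m) x i)"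
      by (simp add: a_def power2_eq_square)
    also have "\<dots> = (\<Sum>i<n. (mat_app ^^ m) x i * (mat_app ^^ Suc (Suc m)) x i)"
      by (simp add: mat_app_self_adjoint)
    finally show ?thesis
      unfolding a_def using Cauchy_Schwarz_ineq_sum by simp
  qed
  have gt: "a 0 < a 1" using not by (simp add: a_def)
  note growth = log_convex_growth[of a, OF nonneg lc gt]
  have AC: "map_mat complex_of_real E \<in> carrier_mat n n" using E by simp
  obtain c1 c2 where c: "norm_bound (map_mat complex_of_real E ^\<^sub>m m) (c1 + c2 * of_nat m ^ (n - 1))" for m
    using spectral_radius_jnf_norm_bound_le_1_upper_triangular[OF AC rho] by blast
  define S where "S = (\<Sum>j<n. \<bar>x j\<bar>)"
  have bound: "a m \<le> real n * S\<^sup>2 * (c1 + c2 * real m ^ (n - 1))\<^sup>2" for m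
  proof -
    let ?b = "c1 + c2 * real m ^ (n - 1)"
    have ent: "\<bar>(E ^\<^sub>m m) $$ (i, j)\<bar> \<le> ?b" if "i < n" "j < n" for i j
    proof -
      have "map_mat complex_of_real E ^\<^sub>m m = map_mat complex_of_real (E ^\<^sub>m m)"
        by (rule of_real_hom.mat_hom_pow[OF E, symmetric])
      then show ?thesis
        using c[of m] that carrier_matD[OF E] by (auto simp: norm_bound_def)
    qed
    have "((mat_app ^^ m) x i)\<^sup>2 \<le> (?b * S)\<^sup>2" if i: "i < n" for i
    proof -
      have "\<bar>(mat_app ^^ m) x i\<bar> \<le> (\<Sum>j<n. \<bar>(E ^\<^sub>m m) $$ (i, j)\<bar> * \<bar>x j\<bar>)"
        unfolding funpow_mat_app[OF i] by (rule order_trans[OF sum_abs]) (simp add: abs_mult)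
      also have "\<dots> \<le> (\<Sum>j<n. ?b * \<bar>x j\<bar>)"
        using ent[OF i] by (intro sum_mono mult_right_mono) auto
      also have "\<dots> = ?b * S" by (simp add: S_def sum_distrib_left)
      finally have "\<bar>(mat_app ^^ m) x i\<bar> \<le> ?b * S" .
      then show ?thesis
        by (metis abs_ge_zero power2_abs power_mono)
    qed
    then have "a m \<le> (\<Sum>i<n. (?b * S)\<^sup>2)" unfolding a_def by (intro sum_mono) auto
    also have "\<dots> = real n * S\<^sup>2 * ?b\<^sup>2" by (simp add: power_mult_distrib)
    finally show ?thesis .
  qed
  have "1 < a 1 / a 0" using growth(1) gt by simp
  from exponential_exceeds_polynomial[OF this growth(1)] growth(2) bound
  show False by (meson not_less order_trans)
qed

lemma quad_form_le:
  assumes rho: "spectral_radius (map_mat complex_of_real E) \<le> 1"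
  shows "(\<Sum>i<n. \<Sum>j<n. E $$ (i, j) * x i * x j) \<le> (\<Sum>i<n. (x i)\<^sup>2)"
proof -
  have "(\<Sum>i<n. \<Sum>j<n. E $$ (i, j) * x i * x j) = (\<Sum>i<n. x i * mat_app x i)"
    by (simp add: mat_app_def sum_distrib_left mult_ac)
  also have "\<dots> \<le> (\<Sum>i<n. ((x i)\<^sup>2 + (mat_app x i)\<^sup>2) / 2)"
  proof (rule sum_mono)
    fix i show "x i * mat_app x i \<le> ((x i)\<^sup>2 + (mat_app x i)\<^sup>2) / 2"
      using sum_squares_bound[of "x i" "mat_app x i"] by simp
  qed
  also have "\<dots> = ((\<Sum>i<n. (x i)\<^sup>2) + (\<Sum>i<n. (mat_app x i)\<^sup>2)) / 2"
    by (simp add: sum.distrib flip: sum_divide_distrib)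
  also have "\<dots> \<le> (\<Sum>i<n. (x i)\<^sup>2)" using mat_app_contraction[OF rho, of x] by simp
  finally show ?thesis .
qed

end

text \<open>
  Let \<open>E v = \<mu> v\<close> with \<open>\<bar>\<mu>\<bar> = 1\<close> and \<open>u\<^sub>i = \<bar>v\<^sub>i\<bar>\<close>. As \<open>E\<close> is nonnegative, the triangle inequality
  gives \<open>u \<le> E u\<close> entrywise, and it remains to pair both sides with \<open>u \<ge> 0\<close>.
\<close>

lemma quad_form_attained:
  fixes E :: "real mat"
  assumes n: "0 < n" and E: "E \<in> carrier_mat n n"
    and nonneg: "\<And>i j. i < n \<Longrightarrow> j < n \<Longrightarrow> 0 \<le> E $$ (i, j)"
    and rho: "spectral_radius (map_mat complex_of_real E) = 1"
  obtains u where "\<exists>i<n. u i \<noteq> 0"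
    "(\<Sum>i<n. (u i)\<^sup>2) \<le> (\<Sum>i<n. \<Sum>j<n. E $$ (i, j) * u i * u j)"
proof -
  let ?A = "map_mat complex_of_real E"
  have A: "?A \<in> carrier_mat n n" using E by simp
  obtain ev where ev: "ev \<in> spectrum ?A" "norm ev = 1"
    using spectral_radius_mem_max(1)[OF A n] rho by auto
  then obtain v where v: "v \<in> carrier_vec n" "v \<noteq> 0\<^sub>v n" "?A *\<^sub>v v = ev \<cdot>\<^sub>v v"
    using A by (auto simp: spectrum_def eigenvalue_def eigenvector_def)
  define u where "u i = cmod (v $ i)" for i
  have u: "\<exists>i<n. u i \<noteq> 0"
    using v(1,2) by (auto simp: u_def vec_eq_iff)
  have le: "u i \<le> (\<Sum>j<n. E $$ (i, j) * u j)" if i: "i < n" for i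
  proof -
    have "ev * v $ i = (?A *\<^sub>v v) $ i" using v i by simp
    also have "\<dots> = (\<Sum>j<n. complex_of_real (E $$ (i, j)) * v $ j)"
      using v(1) E i by (simp add: scalar_prod_def lessThan_atLeast0)
    finally have "u i = cmod (\<Sum>j<n. complex_of_real (E $$ (i, j)) * v $ j)"
      using ev(2) by (metis mult_1 norm_mult u_def)
    also have "\<dots> \<le> (\<Sum>j<n. cmod (complex_of_real (E $$ (i, j)) * v $ j))" by (rule norm_sum)
    also have "\<dots> = (\<Sum>j<n. E $$ (i, j) * u j)"
      using nonneg i by (intro sum.cong refl) (simp add: norm_mult u_def)
    finally show ?thesis .
  qed
  have "(\<Sum>i<n. (u i)\<^sup>2) \<le> (\<Sum>i<n. u i * (\<Sum>j<n. E $$ (i, j) * u j))"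
    unfolding power2_eq_square using le by (intro sum_mono mult_left_mono) (auto simp: u_def)
  also have "\<dots> = (\<Sum>i<n. \<Sum>j<n. E $$ (i, j) * u i * u j)"
    by (simp add: sum_distrib_left mult_ac)
  finally show ?thesis using u that by blast
qed

section \<open>Gram matrices approaching the critical one\<close>

definition coupling :: "nat \<Rightarrow> real"
  where "coupling k = 1 - (1/2) ^ Suc k"

lemma coupling_bounds: "0 \<le> coupling k" "coupling k \<le> 1"
  using power_le_one[of "1/2 :: real" "Suc k"] by (simp_all add: coupling_def)

lemma coupling_tendsto: "coupling \<longlonglongrightarrow> 1"
proof -
  have "(\<lambda>k. 1 - (1/2 :: real) ^ Suc k) \<longlonglongrightarrow> 1 - 0"
    by (intro tendsto_intros LIMSEQ_Suc[OF LIMSEQ_realpow_zero]) auto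
  then show ?thesis by (simp only: coupling_def[abs_def] diff_zero)
qed

text \<open>
  The matrix \<open>I - t\<^sub>k E\<close> for \<open>t\<^sub>k = coupling k\<close>, provided that \<open>E\<close> has zero diagonal.
\<close>

definition near_critical_gram :: "(nat \<Rightarrow> nat \<Rightarrow> real) \<Rightarrow> nat \<Rightarrow> nat \<Rightarrow> nat \<Rightarrow> 'k::real_normed_field"
  where "near_critical_gram e k i j = of_real (if i = j then 1 else - coupling k * e i j)"

context
  fixes n :: nat and e :: "nat \<Rightarrow> nat \<Rightarrow> real"
  assumes n_pos: "0 < n"
    and e_sym: "\<And>i j. i < n \<Longrightarrow> j < n \<Longrightarrow> e j i = e i j"
    and e_nonneg: "\<And>i j. i < n \<Longrightarrow> j < n \<Longrightarrow> 0 \<le> e i j"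
    and e_diag: "\<And>i. i < n \<Longrightarrow> e i i = 0"
    and e_le: "\<And>x :: nat \<Rightarrow> real. (\<Sum>i<n. \<Sum>j<n. e i j * x i * x j) \<le> (\<Sum>i<n. (x i)\<^sup>2)"
begin

lemma near_critical_form:
  fixes z :: "nat \<Rightarrow> 'k::hilbert_scalar"
  shows "(\<Sum>i<n. \<Sum>j<n. near_critical_gram e k i j * z i * conjugate (z j))
    = of_real (\<Sum>i<n. (norm (z i))\<^sup>2)
      - of_real (coupling k) * (\<Sum>i<n. \<Sum>j<n. of_real (e i j) * z i * conjugate (z j))"
proof -
  have "(\<Sum>j<n. near_critical_gram e k i j * z i * conjugate (z j))
      = of_real ((norm (z i))\<^sup>2) - of_real (coupling k) * (\<Sum>j<n. of_real (e i j) * z i * conjugate (z j))"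
    if i: "i < n" for i
  proof -
    have "(\<Sum>j<n. near_critical_gram e k i j * z i * conjugate (z j))
      = (\<Sum>j<n. (if j = i then of_real ((norm (z i))\<^sup>2) else 0)
          - of_real (coupling k) * (of_real (e i j) * z i * conjugate (z j)))"
      using i conjugate_mult_self[of "z i"]
      by (intro sum.cong refl) (auto simp: near_critical_gram_def e_diag mult_ac)
    then show ?thesis using i by (simp add: sum_subtractf sum_distrib_left)
  qed
  then have "(\<Sum>i<n. \<Sum>j<n. near_critical_gram e k i j * z i * conjugate (z j))
      = (\<Sum>i<n. of_real ((norm (z i))\<^sup>2)
          - of_real (coupling k) * (\<Sum>j<n. of_real (e i j) * z i * conjugate (z j)))"
    by (intro sum.cong refl) auto
  then show ?thesis by (simp only: sum_subtractf sum_distrib_left of_real_sum)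
qed

text \<open>
  The value is real because \<open>E\<close> is symmetric. Its modulus is at most the value of the same form at the
  vector of absolute values, where the bound for real vectors applies.
\<close>

lemma real_quad_form:
  fixes z :: "nat \<Rightarrow> 'k::hilbert_scalar"
  obtains s where "(\<Sum>i<n. \<Sum>j<n. of_real (e i j) * z i * conjugate (z j)) = of_real s"
    "\<bar>s\<bar> \<le> (\<Sum>i<n. (norm (z i))\<^sup>2)"
proof -
  let ?S = "\<Sum>i<n. \<Sum>j<n. of_real (e i j) * z i * conjugate (z j)"
  have "conjugate ?S = (\<Sum>i<n. \<Sum>j<n. of_real (e i j) * conjugate (z i) * z j)"
    by (simp add: sum_conjugate conjugate_dist_mul)
  also have "\<dots> = (\<Sum>j<n. \<Sum>i<n. of_real (e i j) * conjugate (z i) * z j)" by (rule sum.swap)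
  also have "\<dots> = ?S"
  proof (intro sum.cong refl)
    fix i j assume "i \<in> {..<n}" "j \<in> {..<n}"
    then have "e j i = e i j" using e_sym by simp
    then show "of_real (e j i) * conjugate (z j) * z i = of_real (e i j) * z i * conjugate (z j)"
      by (simp add: mult_ac)
  qed
  finally obtain s where s: "?S = of_real s" by (rule conjugate_eq_self_imp_real)
  have "\<bar>s\<bar> = norm ?S" by (simp add: s)
  also have "\<dots> \<le> (\<Sum>i<n. \<Sum>j<n. norm (of_real (e i j) * z i * conjugate (z j)))"
    by (intro order_trans[OF norm_sum] sum_mono norm_sum)
  also have "\<dots> = (\<Sum>i<n. \<Sum>j<n. e i j * norm (z i) * norm (z j))"
    using e_nonneg by (intro sum.cong refl) (simp add: norm_mult)
  also have "\<dots> \<le> (\<Sum>i<n. (norm (z i))\<^sup>2)" by (rule e_le)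
  finally show ?thesis using s that by blast
qed

lemma gram_blocks_near_critical:
  "gram_blocks n (near_critical_gram e :: _ \<Rightarrow> _ \<Rightarrow> _ \<Rightarrow> 'k::{hilbert_scalar, banach, second_countable_topology})
    (\<lambda>k. (1/2) ^ Suc k)"
proof
  show "near_critical_gram e k j i = conjugate (near_critical_gram e k i j :: 'k)" if "i < n" "j < n" for i j k
    using e_sym[OF that] by (auto simp: near_critical_gram_def simp del: of_real_mult of_real_minus)
  show "\<exists>r. (\<Sum>i<n. \<Sum>j<n. near_critical_gram e k i j * z i * conjugate (z j)) = (of_real r :: 'k)
      \<and> (1/2) ^ Suc k * (\<Sum>i<n. (norm (z i))\<^sup>2) \<le> r" for k and z :: "nat \<Rightarrow> 'k"
  proof -
    define N where "N = (\<Sum>i<n. (norm (z i))\<^sup>2)"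
    obtain s where s: "(\<Sum>i<n. \<Sum>j<n. of_real (e i j) * z i * conjugate (z j)) = of_real s" "\<bar>s\<bar> \<le> N"
      unfolding N_def by (rule real_quad_form)
    have "coupling k * s \<le> coupling k * N" using s(2) coupling_bounds by (intro mult_left_mono) auto
    then have "(1/2) ^ Suc k * N \<le> N - coupling k * s" by (simp add: coupling_def algebra_simps)
    moreover have "(\<Sum>i<n. \<Sum>j<n. near_critical_gram e k i j * z i * conjugate (z j)) = of_real (N - coupling k * s)"
      unfolding near_critical_form s(1) by (simp only: N_def of_real_diff of_real_mult)
    ultimately show ?thesis unfolding N_def by blast
  qed
qed (use n_pos in auto)

text \<open>
  The hypothesis on \<open>u\<close> says that \<open>u\<close> lies in the kernel of \<open>I - E\<close>. Repeating \<open>u\<close> in every block gives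
  a vector \<open>w\<close> whose \<open>k\<close>-th block has squared norm \<open>2\<^sup>-\<^sup>k\<^sup>-\<^sup>1 \<bar>u\<bar>\<^sup>2\<close>: summable, although the coordinates of
  \<open>w\<close> do not decay.
\<close>

lemma near_critical_subspaces:
  assumes u: "i\<^sub>0 < n" "u i\<^sub>0 \<noteq> 0" "(\<Sum>i<n. (u i)\<^sup>2) \<le> (\<Sum>i<n. \<Sum>j<n. e i j * u i * u j)"
  shows "\<exists>(scale :: 'k::{hilbert_scalar, banach, second_countable_topology} \<Rightarrow> (nat \<Rightarrow> 'k) \<Rightarrow> (nat \<Rightarrow> 'k)) H ip X.
        hilbert_space scale H ip \<and>
        hilbert_space.separable H ip \<and>
        inner_product_space.infinite_dimensional scale H \<and>
        (\<forall>i<n. inner_product_space.closed_subspace scale H ip (X i) \<and>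
               inner_product_space.infinite_dimensional scale (X i)) \<and>
        (\<forall>i<n. \<forall>j<n. i \<noteq> j \<longrightarrow>
           inner_product_space.opnorm_on ip (X j) (inner_product_space.orth_proj ip (X i))
             = e i j) \<and>
        linearly_independent_subspaces n X \<and>
        \<not> closedin (Metric_space.mtopology H (inner_product_space.hdist H ip)) (subspace_sum n X)"
proof -
  interpret g: gram_blocks n "near_critical_gram e :: _ \<Rightarrow> _ \<Rightarrow> _ \<Rightarrow> 'k" "\<lambda>k. (1/2) ^ Suc k"
    by (rule gram_blocks_near_critical)
  have diag: "near_critical_gram e k i i = (1 :: 'k)" for k i
    by (simp add: near_critical_gram_def)
  have norms: "g.opnorm_on (g.coord_space j) (g.orth_proj (g.coord_space i)) = e i j"
    if ij: "i < n" "j < n" "i \<noteq> j" for i j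
  proof (rule g.opnorm_coord_space[OF ij(1,2) diag])
    have eq: "norm (near_critical_gram e k j i :: 'k) = coupling k * e i j" for k
      using ij e_nonneg[OF ij(1,2)] e_sym[OF ij(1,2)] coupling_bounds[of k]
      by (simp add: near_critical_gram_def abs_mult del: of_real_mult of_real_minus)
    show "norm (near_critical_gram e k j i :: 'k) \<le> e i j" for k
      unfolding eq using e_nonneg[OF ij(1,2)] by (intro mult_left_le_one_le) (auto simp: coupling_bounds)
    show "(\<lambda>k. norm (near_critical_gram e k j i :: 'k)) \<longlonglongrightarrow> e i j"
      unfolding eq using tendsto_mult_right[OF coupling_tendsto, of "e i j"] by simp
  qed
  define w :: "nat \<Rightarrow> 'k" where "w l = of_real (u (l mod n))" for l
  define N where "N = (\<Sum>i<n. (u i)\<^sup>2)"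
  \<comment> \<open>The assumed inequality is the reverse of the general bound.\<close>
  have eq: "(\<Sum>i<n. \<Sum>j<n. e i j * u i * u j) = N"
    using u(3) e_le[of u] by (simp add: N_def)
  have qw: "g.q k w = (1/2) ^ Suc k * N" for k
  proof -
    have "g.form k w w = (\<Sum>i<n. \<Sum>j<n. near_critical_gram e k i j * of_real (u i) * conjugate (of_real (u j)))"
      unfolding g.form_def by (intro sum.cong refl) (simp add: w_def)
    also have "\<dots> = of_real (\<Sum>i<n. (u i)\<^sup>2)
        - of_real (coupling k) * of_real (\<Sum>i<n. \<Sum>j<n. e i j * u i * u j)"
      unfolding near_critical_form by simp
    also have "\<dots> = of_real ((1/2) ^ Suc k * N)"
      unfolding eq N_def[symmetric] of_real_mult[symmetric] of_real_diff[symmetric]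
      by (simp add: coupling_def algebra_simps)
    finally have "g.q k w = norm (of_real ((1/2) ^ Suc k * N) :: 'k)"
      by (simp only: g.q_def)
    also have "\<dots> = \<bar>(1/2) ^ Suc k * N\<bar>" by (simp only: norm_of_real)
    finally show ?thesis by (simp add: N_def sum_nonneg)
  qed
  have "summable (\<lambda>k. (1/2) ^ Suc k * N)"
    by (intro summable_mult2 summable_ignore_initial_segment[of _ 1, simplified] summable_geometric) simp
  then have "w \<in> g.H" by (simp only: g.H_def mem_Collect_eq qw)
  moreover have "\<not> summable (\<lambda>k. (norm (w (k * n + i\<^sub>0)))\<^sup>2)"
    using u(1,2) by (simp add: w_def summable_const_iff)
  ultimately have "\<not> closedin g.mtopology (subspace_sum n g.coord_space)"
    using g.sum_coord_spaces_not_closed[OF _ u(1) diag] by blast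
  then show ?thesis
    using g.hilbert_space_axioms g.separable_H g.infinite_dimensional_H g.closed_coord_space
      g.infinite_dimensional_coord_space norms g.independent_coord_spaces
    by (intro exI[of _ fscale] exI[of _ g.H] exI[of _ g.ip] exI[of _ g.coord_space] conjI allI impI)
qed

end

lemma exists_subspaces:
  fixes n :: nat and E :: "real mat"
  assumes n: "n \<ge> 1"
    and E: "E \<in> carrier_mat n n"
    and sym: "transpose_mat E = E"
    and diag: "\<forall>i<n. E $$ (i, i) = 0"
    and nn: "\<forall>i<n. \<forall>j<n. i \<noteq> j \<longrightarrow> E $$ (i, j) \<ge> 0"
    and rho: "spectral_radius (map_mat complex_of_real E) = 1"
  shows "\<exists>(scale :: 'k::{hilbert_scalar, banach, second_countable_topology} \<Rightarrow> (nat \<Rightarrow> 'k) \<Rightarrow> (nat \<Rightarrow> 'k)) H ip X.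
        hilbert_space scale H ip \<and>
        hilbert_space.separable H ip \<and>
        inner_product_space.infinite_dimensional scale H \<and>
        (\<forall>i<n. inner_product_space.closed_subspace scale H ip (X i) \<and>
               inner_product_space.infinite_dimensional scale (X i)) \<and>
        (\<forall>i<n. \<forall>j<n. i \<noteq> j \<longrightarrow>
           inner_product_space.opnorm_on ip (X j) (inner_product_space.orth_proj ip (X i))
             = E $$ (i, j)) \<and>
        linearly_independent_subspaces n X \<and>
        \<not> closedin (Metric_space.mtopology H (inner_product_space.hdist H ip)) (subspace_sum n X)"
proof -
  have nonneg: "0 \<le> E $$ (i, j)" if "i < n" "j < n" for i j
    using diag nn that by (cases "i = j") auto
  have n0: "0 < n" using n by simp
  obtain u where "\<exists>i<n. u i \<noteq> 0"
    and u: "(\<Sum>i<n. (u i)\<^sup>2) \<le> (\<Sum>i<n. \<Sum>j<n. E $$ (i, j) * u i * u j)"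
    using quad_form_attained[OF n0 E nonneg rho] .
  then obtain i where i: "i < n" "u i \<noteq> 0" by blast
  have zero: "E $$ (i, i) = 0" if "i < n" for i
    using diag that by blast
  have rho_le: "spectral_radius (map_mat complex_of_real E) \<le> 1"
    using rho by simp
  show ?thesis
    by (rule near_critical_subspaces[where e = "\<lambda>i j. E $$ (i, j)" and u = u and i\<^sub>0 = i])
      (fact n0 E_sym[OF E sym] nonneg zero quad_form_le[OF E sym rho_le] i u)+
qed

theorem theorem2p3:
  fixes n :: nat and E :: "real mat"
  assumes "n \<ge> 1"
    and "E \<in> carrier_mat n n"
    and "transpose_mat E = E"
    and "\<forall>i<n. E $$ (i, i) = 0"
    and "\<forall>i<n. \<forall>j<n. i \<noteq> j \<longrightarrow> E $$ (i, j) \<ge> 0"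
    and "spectral_radius (map_mat complex_of_real E) = 1"
  shows
    "(\<exists>(scale :: real \<Rightarrow> (nat \<Rightarrow> real) \<Rightarrow> (nat \<Rightarrow> real)) H ip X.
        hilbert_space scale H ip \<and>
        hilbert_space.separable H ip \<and>
        inner_product_space.infinite_dimensional scale H \<and>
        (\<forall>i<n. inner_product_space.closed_subspace scale H ip (X i) \<and>
               inner_product_space.infinite_dimensional scale (X i)) \<and>
        (\<forall>i<n. \<forall>j<n. i \<noteq> j \<longrightarrow>
           inner_product_space.opnorm_on ip (X j) (inner_product_space.orth_proj ip (X i))
             = E $$ (i, j)) \<and>
        linearly_independent_subspaces n X \<and>
        \<not> closedin (Metric_space.mtopology H (inner_product_space.hdist H ip)) (subspace_sum n X))
   \<and> (\<exists>(scale :: complex \<Rightarrow> (nat \<Rightarrow> complex) \<Rightarrow> (nat \<Rightarrow> complex)) H ip X.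
        hilbert_space scale H ip \<and>
        hilbert_space.separable H ip \<and>
        inner_product_space.infinite_dimensional scale H \<and>
        (\<forall>i<n. inner_product_space.closed_subspace scale H ip (X i) \<and>
               inner_product_space.infinite_dimensional scale (X i)) \<and>
        (\<forall>i<n. \<forall>j<n. i \<noteq> j \<longrightarrow>
           inner_product_space.opnorm_on ip (X j) (inner_product_space.orth_proj ip (X i))
             = E $$ (i, j)) \<and>
        linearly_independent_subspaces n X \<and>
        \<not> closedin (Metric_space.mtopology H (inner_product_space.hdist H ip)) (subspace_sum n X))"
  using exists_subspaces[OF assms, where 'k = real] exists_subspaces[OF assms, where 'k = complex]
  by (rule conjI)

end
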